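(* Let $\Omega\subset\mathbb{R}^n$ be a non-empty open convex set. Assume $g,h:\Omega\to\mathbb{R}$ are finite continuous convex functions in $\Omega$ and let $f(x)=g(x)-h(x)$ for $x\in\Omega$. Take $x_0\in\Omega$ and $G\subset\Omega$ an open bounded set such that $x_0\in G\subset\bar G\subset\Omega$. Let $r_{g,x_0}$ and $r_{h,x_0}$ be the radii of the minimal bounding spheres of $\partial_-g(x_0)$ and $\partial_-h(x_0)$, respectively. Then $$\liminf_{\lambda\to+\infty}\lambda E_\lambda(f_G)(x_0)\ge\frac{(r_{g,x_0}-r_{h,x_0})^2}{4}.$$
   Context: $|\cdot|$ is the Euclidean norm on $\mathbb{R}^n$. $\mathsf{co}[F]$ denotes the convex envelope of $F:\mathbb{R}^n\to(-\infty,+\infty]$, i.e. the largest convex function not exceeding $F$. For $F:\mathbb{R}^n\to\mathbb{R}$ of linear growth and $\lambda>0$: the lower transform is $C^l_\lambda(F)(x)=\mathsf{co}[F+\lambda|\cdot|^2](x)-\lambda|x|^2$, the upper transform is $C^u_\lambda(F)(x)=\lambda|x|^2-\mathsf{co}[\lambda|\cdot|^2-F](x)$, and the edge transform is $E_\lambda(F)(x)=C^u_\lambda(F)(x)-C^l_\lambda(F)(x)$. $f$ is locally Lipschitz in $\Omega$. $f_G:\mathbb{R}^n\to\mathbb{R}$ denotes any Lipschitz extension of $f|_{\bar G}$ to $\mathbb{R}^n$ having the same Lipschitz constant as $f|_{\bar G}$ (it exists by Kirszbraun's theorem; the result does not depend on its choice). For a convex function $g:\Omega\to\mathbb{R}$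 and $x\in\Omega$, the subdifferential is $\partial_-g(x)=\{u\in\mathbb{R}^n: g(y)-g(x)-u\cdot(y-x)\ge0 \text{ for all } y\in\Omega\}$, a non-empty compact convex set. Minimal bounding sphere: every non-empty compact $K\subset\mathbb{R}^n$ is contained in a unique closed ball of smallest radius; the boundary sphere of this ball is the minimal bounding sphere of $K$, with the same centre and radius (the radius is $0$ if $K$ is a single point). *)

theory Defs
  imports "HOL-Analysis.Analysis"
begin

text \<open>
  The convex envelope is the greatest element, in the pointwise order on functions, of the convex
  functions below \<open>F\<close>. Only finite-valued \<open>F\<close> are needed below, and a convex function with values
  in \<open>(-\<infinity>, \<infinity>]\<close> lying below such an \<open>F\<close> is itself finite, so real-valued functions suffice. The envelope
  exists as soon as there is some convex minorant (see the lemma \<open>convex_envelope\<close>).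
\<close>

definition convex_envelope :: "('a::real_vector \<Rightarrow> real) \<Rightarrow> 'a \<Rightarrow> real" where
  "convex_envelope F = (GREATEST \<phi>. convex_on UNIV \<phi> \<and> \<phi> \<le> F)"

definition lower_transform :: "real \<Rightarrow> ('a::real_inner \<Rightarrow> real) \<Rightarrow> 'a \<Rightarrow> real" where
  "lower_transform lam F x =
     convex_envelope (\<lambda>y. F y + lam * (norm y)\<^sup>2) x - lam * (norm x)\<^sup>2"

definition upper_transform :: "real \<Rightarrow> ('a::real_inner \<Rightarrow> real) \<Rightarrow> 'a \<Rightarrow> real" where
  "upper_transform lam F x =
     lam * (norm x)\<^sup>2 - convex_envelope (\<lambda>y. lam * (norm y)\<^sup>2 - F y) x"

definition edge_transform :: "real \<Rightarrow> ('a::real_inner \<Rightarrow> real) \<Rightarrow> 'a \<Rightarrow> real" where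
  "edge_transform lam F x = upper_transform lam F x - lower_transform lam F x"

definition subdifferential ::
  "'a::real_inner set \<Rightarrow> ('a \<Rightarrow> real) \<Rightarrow> 'a \<Rightarrow> 'a set" where
  "subdifferential \<Omega> g x = {u. \<forall>y\<in>\<Omega>. g y - g x - u \<bullet> (y - x) \<ge> 0}"

text \<open>
  For non-empty \<open>K\<close> every competing \<open>r\<close> is automatically nonnegative, since \<open>cball c r = {}\<close>
  for \<open>r < 0\<close>. The minimum is attained when \<open>K\<close> is bounded and non-empty
  (see the lemma \<open>min_bounding_radius\<close>).
\<close>

definition min_bounding_radius :: "'a::metric_space set \<Rightarrow> real" where
  "min_bounding_radius K = (LEAST r. \<exists>c. K \<subseteq> cball c r)"

definition lipschitz_constant ::
  "'a::metric_space set \<Rightarrow> ('a \<Rightarrow> 'b::metric_space) \<Rightarrow> real" where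
  "lipschitz_constant S f = Inf {L. L-lipschitz_on S f}"

definition lipschitz_extension ::
  "'a::metric_space set \<Rightarrow> ('a \<Rightarrow> real) \<Rightarrow> ('a \<Rightarrow> real) \<Rightarrow> bool" where
  "lipschitz_extension S f F \<longleftrightarrow>
     (\<forall>x\<in>S. F x = f x) \<and> (\<exists>L. L-lipschitz_on UNIV F) \<and>
     lipschitz_constant UNIV F = lipschitz_constant S f"

lemma convex_envelope:
  fixes F :: "'a::real_vector \<Rightarrow> real"
  assumes "convex_on UNIV \<psi>" "\<psi> \<le> F"
  shows "convex_on UNIV (convex_envelope F)"
    and "convex_envelope F \<le> F"
    and "\<And>\<phi>. convex_on UNIV \<phi> \<Longrightarrow> \<phi> \<le> F \<Longrightarrow> \<phi> \<le> convex_envelope F"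
proof -
  define M where "M = {\<phi>. convex_on UNIV \<phi> \<and> \<phi> \<le> F}"
  define c where "c x = (SUP \<phi>\<in>M. \<phi> x)" for x
  have ne: "M \<noteq> {}" using assms by (auto simp: M_def)
  have bdd: "bdd_above ((\<lambda>\<phi>. \<phi> x) ` M)" for x
    by (rule bdd_aboveI[of _ "F x"]) (auto simp: M_def le_fun_def)
  have up: "\<phi> x \<le> c x" if "\<phi> \<in> M" for \<phi> x
    unfolding c_def using bdd that by (rule cSUP_upper2) auto
  have conv: "convex_on UNIV c"
  proof (rule convex_onI)
    fix t :: real and x y :: 'a assume t: "0 < t" "t < 1"
    show "c ((1 - t) *\<^sub>R x + t *\<^sub>R y) \<le> (1 - t) * c x + t * c y"
      unfolding c_def[of "(1 - t) *\<^sub>R x + t *\<^sub>R y"]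
    proof (rule cSUP_least[OF ne])
      fix \<phi> assume \<phi>: "\<phi> \<in> M"
      then have "convex_on UNIV \<phi>" by (simp add: M_def)
      from convex_onD[OF this, of t x y] t
      have "\<phi> ((1 - t) *\<^sub>R x + t *\<^sub>R y) \<le> (1 - t) * \<phi> x + t * \<phi> y" by simp
      also have "\<dots> \<le> (1 - t) * c x + t * c y"
        using t up[OF \<phi>] by (intro add_mono mult_left_mono) auto
      finally show "\<phi> ((1 - t) *\<^sub>R x + t *\<^sub>R y) \<le> (1 - t) * c x + t * c y" .
    qed
  qed simp
  have le: "c \<le> F"
    unfolding le_fun_def c_def using ne by (auto intro!: cSUP_least simp: M_def le_fun_def)
  have great: "\<phi> \<le> c" if "convex_on UNIV \<phi>" "\<phi> \<le> F" for \<phi>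
    using up that by (auto simp: M_def le_fun_def)
  have "convex_envelope F = c"
    unfolding convex_envelope_def using conv le great by (intro Greatest_equality) auto
  with conv le great
  show "convex_on UNIV (convex_envelope F)" "convex_envelope F \<le> F"
    "\<And>\<phi>. convex_on UNIV \<phi> \<Longrightarrow> \<phi> \<le> F \<Longrightarrow> \<phi> \<le> convex_envelope F"
    by auto
qed

lemma min_bounding_radius:
  fixes K :: "'a::heine_borel set"
  assumes "bounded K" "K \<noteq> {}"
  shows "\<exists>c. K \<subseteq> cball c (min_bounding_radius K)"
    and "\<And>c r. K \<subseteq> cball c r \<Longrightarrow> min_bounding_radius K \<le> r"
proof -
  obtain a R where R: "K \<subseteq> cball a R"
    using assms(1) by (metis bounded_subset_cball)
  obtain k where k: "k \<in> K" using assms(2) by auto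
  define A where "A = (cball k R \<times> {0..R}) \<inter> (\<Inter>y\<in>K. {p::'a \<times> real. dist (fst p) y \<le> snd p})"
  have "compact A"
    unfolding A_def
    by (intro compact_Int_closed compact_Times closed_INT ballI closed_Collect_le
        continuous_intros) auto
  moreover have A_iff: "(c, r) \<in> A \<longleftrightarrow> r \<le> R \<and> K \<subseteq> cball c r" for c r
  proof
    assume *: "r \<le> R \<and> K \<subseteq> cball c r"
    then have "dist c k \<le> r" using k by auto
    with * show "(c, r) \<in> A" using zero_le_dist[of c k]
      by (auto simp: A_def dist_commute simp del: zero_le_dist intro: order_trans)
  qed (auto simp: A_def)
  moreover have "(a, R) \<in> A" using R by (simp add: A_iff)
  ultimately have "\<exists>p\<in>A. \<forall>q\<in>A. snd p \<le> snd q"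
    by (intro continuous_attains_inf continuous_on_snd continuous_on_id) auto
  then obtain p where p: "p \<in> A" "\<And>q. q \<in> A \<Longrightarrow> snd p \<le> snd q"
    by blast
  have in_p: "K \<subseteq> cball (fst p) (snd p)" and pR: "snd p \<le> R"
    using p(1) A_iff[of "fst p" "snd p"] by auto
  have least: "snd p \<le> r" if "K \<subseteq> cball c r" for c r
    using p(2)[of "(c, r)"] that pR by (cases "r \<le> R") (auto simp: A_iff)
  have eq: "min_bounding_radius K = snd p"
    unfolding min_bounding_radius_def using in_p least by (intro Least_equality) auto
  show "\<exists>c. K \<subseteq> cball c (min_bounding_radius K)" using in_p eq by auto
  show "\<And>c r. K \<subseteq> cball c r \<Longrightarrow> min_bounding_radius K \<le> r" using least eq by auto
qed

end

theory Submission
  imports Defs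
begin

text \<open>The edge transform does not see the sign of its argument, so \<open>g\<close> and
  \<open>h\<close> can be interchanged and the case r_g > r_h is the essential one; for equal radii
  nonnegativity suffices. Let c and d be the centres of the bounding balls of the two
  subdifferentials. The lower transform lies below the function, so it is enough to bound the lower
  transform of g - h with its sign reversed, at the given point x. A convex envelope at x is at most
  any convex combination of values at points averaging to x.

  Such points come from the geometry of the ball: c lies in the convex hull of the contact points u
  (\<open>min_bounding_center_in_convex_hull\<close>), so the points y = x + s (u - c) / r_g have x
  in their hull. There the subgradient u gives g(y) - g(x) at least c . (y - x) + r_g s, while
  \<open>convex_increment_le\<close> gives h(y) - h(x) at most d . (y - x) + (r_h + e) s for small
  s. The linear terms average out (\<open>lower_transform_le_hull\<close>), leaving a gain (r_g -
  r_h - e) s against a cost lam s^2. Taking s = (r_g - r_h) / (2 lam), which tends to 0, yields the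
  constant 1/4.\<close>

section \<open>Subdifferentials\<close>

text \<open>A hyperplane separating (x, g x) from the strict epigraph cannot be vertical, because x
  is interior; its slope is a subgradient.\<close>

lemma subdifferential_nonempty:
  fixes g :: "'a::euclidean_space \<Rightarrow> real"
  assumes "open \<Omega>" "convex_on \<Omega> g" "x \<in> \<Omega>"
  shows "subdifferential \<Omega> g x \<noteq> {}"
proof -
  define S where "S = {(y, t). y \<in> \<Omega> \<and> g y < t}"
  have conv: "convex \<Omega>" using assms(2) by (rule convex_on_imp_convex)
  have S: "convex S"
  proof (rule convexI)
    fix p q :: "'a \<times> real" and u v :: real
    assume "p \<in> S" "q \<in> S" and uv: "0 \<le> u" "0 \<le> v" "u + v = 1"
    then have 1: "fst p \<in> \<Omega>" "g (fst p) < snd p" "fst q \<in> \<Omega>" "g (fst q) < snd q"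
      by (auto simp: S_def)
    have "g (u *\<^sub>R fst p + v *\<^sub>R fst q) \<le> u * g (fst p) + v * g (fst q)"
      using assms(2) 1 uv unfolding convex_on_def by blast
    also have "\<dots> < u * snd p + v * snd q"
      using 1 uv
      by (smt (verit) mult_left_mono mult_strict_left_mono)
    finally show "u *\<^sub>R p + v *\<^sub>R q \<in> S"
      using convexD[OF conv 1(1) 1(3) uv] by (simp add: S_def split_beta)
  qed
  have "(x, g x + 1) \<in> S" using assms by (simp add: S_def)
  then have "S \<noteq> {}" by blast
  moreover have "S \<inter> {(x, g x)} = {}" by (auto simp: S_def)
  ultimately obtain a b where ab: "a \<noteq> 0" "\<And>p. p \<in> S \<Longrightarrow> a \<bullet> p \<le> b" "a \<bullet> (x, g x) \<ge> b"
    using separating_hyperplane_sets[OF S convex_singleton[of "(x, g x)"]] by blast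
  obtain v s where a: "a = (v, s)" by force
  have le: "v \<bullet> (y - x) + s * (t - g x) \<le> 0" if "y \<in> \<Omega>" "g y < t" for y t
    using ab(2)[of "(y, t)"] ab(3) that by (simp add: a S_def algebra_simps)
  have s: "s \<le> 0" using le[of x "g x + 1"] assms by simp
  \<comment> \<open>If the hyperplane were vertical, a short step from x along \<open>v\<close>
    would stay in the domain but violate \<open>le\<close>.\<close>
  have "s \<noteq> 0"
  proof
    assume s0: "s = 0"
    obtain e where e: "e > 0" "cball x e \<subseteq> \<Omega>"
      using assms open_contains_cball by blast
    have v: "v \<noteq> 0" using ab(1) a s0 by (auto simp: zero_prod_def)
    have "x + (e / norm v) *\<^sub>R v \<in> \<Omega>" using e v by (intro subsetD[OF e(2)]) (simp add: dist_norm)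
    then have "v \<bullet> ((e / norm v) *\<^sub>R v) \<le> 0"
      using le[of "x + (e / norm v) *\<^sub>R v" "g (x + (e / norm v) *\<^sub>R v) + 1"] s0 by simp
    moreover have "v \<bullet> ((e / norm v) *\<^sub>R v) > 0" using e v by simp
    ultimately show False by simp
  qed
  with s have s: "s < 0" by simp
  have "(- (1 / s)) *\<^sub>R v \<in> subdifferential \<Omega> g x"
    unfolding subdifferential_def
  proof (intro CollectI ballI)
    fix y assume y: "y \<in> \<Omega>"
    \<comment> \<open>The epigraph is strict, so the inequality holds for t above g y and passes to
      g y by density.\<close>
    have "g x - v \<bullet> (y - x) / s \<le> t" if "g y < t" for t
      using le[OF y that] s by (simp add: divide_simps right_diff_distrib mult.commute)
    then have "g x - v \<bullet> (y - x) / s \<le> g y" by (rule dense_ge)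
    then show "g y - g x - ((- (1 / s)) *\<^sub>R v) \<bullet> (y - x) \<ge> 0" by simp
  qed
  then show ?thesis by blast
qed

text \<open>A step of fixed length along a subgradient p raises the function by at least a multiple
  of norm p, yet the function is bounded on a compact ball. Uniformity in y is what allows
  subsequences of subgradients to be extracted.\<close>

lemma subdifferential_locally_bounded:
  fixes g :: "'a::euclidean_space \<Rightarrow> real"
  assumes "open \<Omega>" "continuous_on \<Omega> g" "x \<in> \<Omega>"
  obtains e B where "e > 0" "cball x e \<subseteq> \<Omega>"
    "\<And>y p. y \<in> cball x e \<Longrightarrow> p \<in> subdifferential \<Omega> g y \<Longrightarrow> norm p \<le> B"
proof -
  obtain d where d: "d > 0" "cball x d \<subseteq> \<Omega>"
    using assms open_contains_cball by blast
  have "compact (g ` cball x d)"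
    using assms d by (intro compact_continuous_image) (auto intro: continuous_on_subset)
  then have "bounded (g ` cball x d)" by (rule compact_imp_bounded)
  then obtain M where "\<forall>v\<in>g ` cball x d. norm v \<le> M" unfolding bounded_iff by (elim exE)
  then have M: "\<bar>g y\<bar> \<le> M" if "y \<in> cball x d" for y using that by simp
  have "norm p \<le> 4 * M / d" if y: "y \<in> cball x (d / 2)" and p: "p \<in> subdifferential \<Omega> g y" for y p
  proof (cases "p = 0")
    case True
    then show ?thesis using M[of x] d by auto
  next
    case False
    define z where "z = y + (d / 2 / norm p) *\<^sub>R p"
    have "dist x z \<le> dist x y + dist y z" by (rule dist_triangle)
    moreover have "dist y z = d / 2" using False d by (simp add: z_def dist_norm)
    ultimately have z: "z \<in> cball x d" using y by simp
    have "p \<bullet> (z - y) \<le> g z - g y"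
      using p z d by (auto simp: subdifferential_def)
    moreover have "p \<bullet> (z - y) = norm p * d / 2"
      using False by (simp add: z_def dot_square_norm power2_eq_square)
    moreover have "g z - g y \<le> 2 * M" using M[OF z] M[of y] y d by auto
    ultimately show ?thesis using d by (simp add: field_simps)
  qed
  moreover have "cball x (d / 2) \<subseteq> \<Omega>" using d by auto
  ultimately show thesis using d(1) by (intro that[of "d / 2"]) auto
qed

lemma subdifferential_compact:
  fixes g :: "'a::euclidean_space \<Rightarrow> real"
  assumes "open \<Omega>" "continuous_on \<Omega> g" "x \<in> \<Omega>"
  shows "compact (subdifferential \<Omega> g x)"
proof -
  obtain e B where e: "e > 0"
    "\<And>y p. y \<in> cball x e \<Longrightarrow> p \<in> subdifferential \<Omega> g y \<Longrightarrow> norm p \<le> B"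
    using subdifferential_locally_bounded[OF assms] by metis
  then have "bounded (subdifferential \<Omega> g x)"
    by (intro boundedI[of _ B] e(2)[of x]) auto
  moreover have "subdifferential \<Omega> g x = (\<Inter>y\<in>\<Omega>. {u. 0 \<le> g y - g x - u \<bullet> (y - x)})"
    by (auto simp: subdifferential_def)
  moreover have "closed \<dots>"
    by (intro closed_INT ballI closed_Collect_le continuous_intros)
  ultimately show ?thesis by (simp add: compact_eq_bounded_closed)
qed

text \<open>
  A subgradient at \<open>y\<close> bounds \<open>h y - h x\<close> from above; as \<open>y\<close> tends to \<open>x\<close>, these subgradients
  accumulate only on the subdifferential at \<open>x\<close>, hence in the ball containing it.
\<close>

lemma convex_increment_le:
  fixes h :: "'a::euclidean_space \<Rightarrow> real"
  assumes "open \<Omega>" "continuous_on \<Omega> h" "convex_on \<Omega> h" "x \<in> \<Omega>"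
    and sub: "subdifferential \<Omega> h x \<subseteq> cball d r" and "\<epsilon> > 0"
  shows "\<forall>\<^sub>F y in nhds x. h y - h x \<le> d \<bullet> (y - x) + (r + \<epsilon>) * norm (y - x)"
proof (rule ccontr)
  define P where "P y \<longleftrightarrow> h y - h x \<le> d \<bullet> (y - x) + (r + \<epsilon>) * norm (y - x)" for y
  assume "\<not> (\<forall>\<^sub>F y in nhds x. h y - h x \<le> d \<bullet> (y - x) + (r + \<epsilon>) * norm (y - x))"
  then have neg: "\<exists>y. dist y x < e \<and> \<not> P y" if "e > 0" for e
    using that by (auto simp: eventually_nhds_metric P_def)
  obtain e B where e: "e > 0" "cball x e \<subseteq> \<Omega>"
    "\<And>y p. y \<in> cball x e \<Longrightarrow> p \<in> subdifferential \<Omega> h y \<Longrightarrow> norm p \<le> B"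
    using subdifferential_locally_bounded[OF assms(1,2,4)] by metis
  have "\<exists>y. dist y x < min e (inverse (real (Suc k))) \<and> \<not> P y" for k
    using e(1) by (intro neg) auto
  then obtain y where y: "\<And>k. dist (y k) x < min e (inverse (real (Suc k)))" "\<And>k. \<not> P (y k)"
    by metis
  have yx: "y \<longlonglongrightarrow> x"
    by (rule metric_tendsto_imp_tendsto[OF LIMSEQ_inverse_real_of_nat])
      (use y(1) in \<open>auto intro!: always_eventually less_imp_le\<close>)
  have ye: "y k \<in> cball x e" for k using y(1)[of k] by (simp add: dist_commute)
  then have y\<Omega>: "y k \<in> \<Omega>" for k using e by blast
  have "\<exists>p. p \<in> subdifferential \<Omega> h (y k)" for k
    using subdifferential_nonempty[OF assms(1,3) y\<Omega>] by blast
  then obtain p where p: "\<And>k. p k \<in> subdifferential \<Omega> h (y k)" by metis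
  have "bounded (range p)" using e(3)[OF ye p] by (auto simp: bounded_iff)
  then obtain q \<sigma> where \<sigma>: "strict_mono \<sigma>" "(p \<circ> \<sigma>) \<longlonglongrightarrow> q"
    using bounded_imp_convergent_subsequence by blast
  have y\<sigma>: "(y \<circ> \<sigma>) \<longlonglongrightarrow> x" using LIMSEQ_subseq_LIMSEQ[OF yx \<sigma>(1)] .
  have "isCont h x"
    using assms by (simp add: continuous_on_eq_continuous_at)
  then have h\<sigma>: "(\<lambda>k. h ((y \<circ> \<sigma>) k)) \<longlonglongrightarrow> h x" using y\<sigma> by (rule isCont_tendsto_compose)
  \<comment> \<open>The subgradient inequality at y k passes to the limit because h is
    continuous.\<close>
  have "q \<in> subdifferential \<Omega> h x"
    unfolding subdifferential_def
  proof clarify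
    fix z assume z: "z \<in> \<Omega>"
    have "(\<lambda>k. h z - h ((y \<circ> \<sigma>) k) - (p \<circ> \<sigma>) k \<bullet> (z - (y \<circ> \<sigma>) k)) \<longlonglongrightarrow> h z - h x - q \<bullet> (z - x)"
      by (intro tendsto_intros h\<sigma> y\<sigma> \<sigma>(2))
    moreover have "h z - h ((y \<circ> \<sigma>) k) - (p \<circ> \<sigma>) k \<bullet> (z - (y \<circ> \<sigma>) k) \<ge> 0" for k
      using p[of "\<sigma> k"] z by (simp add: subdifferential_def)
    ultimately show "h z - h x - q \<bullet> (z - x) \<ge> 0"
      by (intro LIMSEQ_le_const) auto
  qed
  then have q: "norm (q - d) \<le> r" using sub by (auto simp: dist_norm norm_minus_commute)
  obtain k where k: "dist ((p \<circ> \<sigma>) k) q < \<epsilon>"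
    using \<sigma>(2) \<open>\<epsilon> > 0\<close> by (metis eventually_sequentially order_refl tendstoD)
  define w where "w = y (\<sigma> k)"
  \<comment> \<open>Testing the subgradient at \<open>w\<close> against the point x turns a lower
    bound into an upper bound for the increment.\<close>
  have "h x - h w - p (\<sigma> k) \<bullet> (x - w) \<ge> 0"
    using p[of "\<sigma> k"] assms(4) by (simp add: subdifferential_def w_def)
  then have "h w - h x \<le> p (\<sigma> k) \<bullet> (w - x)" by (simp add: inner_diff_right)
  also have "\<dots> = d \<bullet> (w - x) + (p (\<sigma> k) - d) \<bullet> (w - x)" by (simp add: algebra_simps)
  also have "(p (\<sigma> k) - d) \<bullet> (w - x) \<le> norm (p (\<sigma> k) - d) * norm (w - x)"
    by (rule norm_cauchy_schwarz)
  also have "norm (p (\<sigma> k) - d) * norm (w - x) \<le> (r + \<epsilon>) * norm (w - x)"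
  proof (rule mult_right_mono)
    have "norm (p (\<sigma> k) - d) \<le> norm (p (\<sigma> k) - q) + norm (q - d)"
      by norm
    then show "norm (p (\<sigma> k) - d) \<le> r + \<epsilon>" using q k by (simp add: dist_norm)
  qed simp
  finally have "P w" by (simp add: P_def)
  then show False using y(2) by (simp add: w_def)
qed

section \<open>Minimal bounding spheres\<close>

text \<open>If the centre were separated from the contact points, moving it towards them would shrink the ball.\<close>

lemma min_bounding_center_in_convex_hull:
  fixes K :: "'a::euclidean_space set"
  assumes K: "compact K" "K \<noteq> {}" and c: "K \<subseteq> cball c r"
    and r: "r = min_bounding_radius K"
  shows "c \<in> convex hull {u\<in>K. norm (u - c) = r}"
proof (rule ccontr)
  define A where "A = (\<lambda>u. u - c) ` {u\<in>K. norm (u - c) = r}"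
  assume "c \<notin> convex hull {u\<in>K. norm (u - c) = r}"
  moreover have A: "A = (+) (- c) ` {u\<in>K. norm (u - c) = r}" by (simp add: A_def)
  ultimately have 0: "0 \<notin> convex hull A"
    unfolding A convex_hull_translation by auto
  have "closed {u. norm (u - c) = r}"
    by (intro closed_Collect_eq continuous_intros)
  then have "compact (K \<inter> {u. norm (u - c) = r})"
    by (rule compact_Int_closed[OF K(1)])
  then have "compact {u\<in>K. norm (u - c) = r}" by (simp add: Collect_conj_eq)
  then have "compact A" unfolding A_def by (intro compact_continuous_image continuous_intros)
  then have "closed (convex hull A)" by (intro compact_imp_closed compact_convex_hull)
  then obtain a b where ab: "a \<noteq> 0" "0 < b" "\<And>v. v \<in> convex hull A \<Longrightarrow> b < a \<bullet> v"
    using separating_hyperplane_closed_0[OF convex_convex_hull _ 0] by metis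
  have abA: "b < a \<bullet> (u - c)" if "u \<in> K" "norm (u - c) = r" for u
    using that by (intro ab(3) hull_inc) (auto simp: A_def)
  have Kr: "norm (u - c) \<le> r" if "u \<in> K" for u
    using c that by (auto simp: dist_norm norm_minus_commute)
  obtain k where "k \<in> K" using K(2) by blast
  then have r0: "r \<ge> 0" using order_trans[OF norm_ge_zero Kr] by blast
  \<comment> \<open>On \<open>C\<close> a move along \<open>a\<close> may increase the distance, but
    \<open>C\<close> misses the contact points, so by compactness it stays inside the sphere by a
    margin \<open>m\<close>.\<close>
  define C where "C = K \<inter> {u. a \<bullet> (u - c) \<le> b}"
  have "compact C" unfolding C_def
    by (intro compact_Int_closed K closed_Collect_le continuous_intros)
  have "\<exists>m>0. \<forall>u\<in>C. (norm (u - c))\<^sup>2 \<le> r\<^sup>2 - m"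
  proof (cases "C = {}")
    case True
    then show ?thesis by (auto intro: exI[of _ 1])
  next
    case False
    have "\<exists>u\<in>C. \<forall>v\<in>C. norm (v - c) \<le> norm (u - c)"
      using \<open>compact C\<close> False by (intro continuous_attains_sup continuous_intros)
    then obtain u where u: "u \<in> C" "\<And>v. v \<in> C \<Longrightarrow> norm (v - c) \<le> norm (u - c)" by blast
    have "norm (u - c) < r" using Kr[of u] abA[of u] u(1) by (force simp: C_def)
    then have "(norm (u - c))\<^sup>2 < r\<^sup>2" by (intro power_strict_mono) auto
    moreover have "(norm (v - c))\<^sup>2 \<le> (norm (u - c))\<^sup>2" if "v \<in> C" for v
      using u(2)[OF that] by (intro power_mono) auto
    ultimately show ?thesis by (intro exI[of _ "r\<^sup>2 - (norm (u - c))\<^sup>2"]) auto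
  qed
  then obtain m where m: "m > 0" "\<And>u. u \<in> C \<Longrightarrow> (norm (u - c))\<^sup>2 \<le> r\<^sup>2 - m" by blast
  have lim: "((\<lambda>t. D - 2 * t * R - t\<^sup>2 * (norm a)\<^sup>2) \<longlongrightarrow> D) (at_right 0)" for D R :: real
    by (auto intro!: tendsto_eq_intros)
  have na: "norm a > 0" using ab by simp
  have "\<forall>\<^sub>F t in at_right 0. 0 < m - 2 * t * (norm a * r) - t\<^sup>2 * (norm a)\<^sup>2"
    using m(1) by (intro order_tendstoD(1)[OF lim])
  moreover have "\<forall>\<^sub>F t in at_right (0::real). t < 2 * b / (norm a)\<^sup>2"
    using ab na by (intro order_tendstoD(2)[OF tendsto_ident_at]) auto
  moreover have "\<forall>\<^sub>F t in at_right (0::real). t > 0" by (rule eventually_at_right_less)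
  ultimately have "\<forall>\<^sub>F t in at_right 0. 0 < m - 2 * t * (norm a * r) - t\<^sup>2 * (norm a)\<^sup>2
      \<and> t < 2 * b / (norm a)\<^sup>2 \<and> t > 0" by (intro eventually_conj)
  then obtain t where t: "0 < m - 2 * t * (norm a * r) - t\<^sup>2 * (norm a)\<^sup>2"
    "t < 2 * b / (norm a)\<^sup>2" "t > 0"
    using eventually_happens'[OF trivial_limit_at_right_real] by blast
  have t': "t\<^sup>2 * (norm a)\<^sup>2 < 2 * t * b"
    using t(2,3) na by (simp add: field_simps power2_eq_square)
  \<comment> \<open>The two arguments are the net decreases of the squared distance on
    \<open>C\<close> and off \<open>C\<close>.\<close>
  define \<eta> where "\<eta> = min (m - 2 * t * (norm a * r) - t\<^sup>2 * (norm a)\<^sup>2) (2 * t * b - t\<^sup>2 * (norm a)\<^sup>2)"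
  have \<eta>: "\<eta> > 0" using t t' by (simp add: \<eta>_def)
  have new: "(norm (u - (c + t *\<^sub>R a)))\<^sup>2 \<le> r\<^sup>2 - \<eta>" if u: "u \<in> K" for u
  proof -
    have eq: "(norm (u - (c + t *\<^sub>R a)))\<^sup>2 = (norm (u - c))\<^sup>2 - 2 * t * (a \<bullet> (u - c)) + t\<^sup>2 * (norm a)\<^sup>2"
      unfolding power2_norm_eq_inner
      by (simp add: algebra_simps power2_eq_square inner_commute)
    show ?thesis
    proof (cases "a \<bullet> (u - c) \<le> b")
      case True
      then have "(norm (u - c))\<^sup>2 \<le> r\<^sup>2 - m" using u by (intro m) (simp add: C_def)
      moreover have "\<bar>a \<bullet> (u - c)\<bar> \<le> norm a * r"
        using Cauchy_Schwarz_ineq2 mult_left_mono[OF Kr[OF u] norm_ge_zero] by (rule order_trans)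
      then have "t * (- (a \<bullet> (u - c))) \<le> t * (norm a * r)" using t by (intro mult_left_mono) auto
      ultimately show ?thesis
        unfolding eq \<eta>_def by linarith
    next
      case False
      then have "t * b \<le> t * (a \<bullet> (u - c))" using t by (intro mult_left_mono) auto
      moreover have "(norm (u - c))\<^sup>2 \<le> r\<^sup>2" using Kr[OF u] by (intro power_mono) auto
      ultimately show ?thesis unfolding eq \<eta>_def by linarith
    qed
  qed
  have "K \<subseteq> cball (c + t *\<^sub>R a) (sqrt (r\<^sup>2 - \<eta>))"
    using new by (auto simp: dist_norm norm_minus_commute intro!: real_le_rsqrt)
  then have "r \<le> sqrt (r\<^sup>2 - \<eta>)"
    using min_bounding_radius(2)[OF compact_imp_bounded[OF K(1)] K(2)] r by metis
  moreover have "sqrt (r\<^sup>2 - \<eta>) < sqrt (r\<^sup>2)" using \<eta> by (intro real_sqrt_less_mono) simp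
  ultimately show False using r0 by simp
qed

section \<open>The edge transform\<close>

text \<open>Completing the square: the constant is F 0 plus the minimum of lam t^2 - L t. This
  minorant is what makes the envelope, defined by \<open>GREATEST\<close>, meaningful.\<close>

lemma lipschitz_quadratic_minorant:
  fixes F :: "'a::real_inner \<Rightarrow> real"
  assumes "L-lipschitz_on UNIV F" "lam > 0"
  shows "\<exists>\<psi>. convex_on UNIV \<psi> \<and> \<psi> \<le> (\<lambda>y. F y + lam * (norm y)\<^sup>2)"
proof (intro exI conjI)
  show "convex_on UNIV (\<lambda>_::'a. F 0 - L\<^sup>2 / (4 * lam))" by (simp add: convex_on_const)
  show "(\<lambda>_. F 0 - L\<^sup>2 / (4 * lam)) \<le> (\<lambda>y. F y + lam * (norm y)\<^sup>2)"
  proof (rule le_funI)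
    fix y
    have "\<bar>F y - F 0\<bar> \<le> L * norm y"
      using lipschitz_onD[OF assms(1), of y 0] by (simp add: dist_real_def)
    moreover have "lam * (norm y)\<^sup>2 - L * norm y + L\<^sup>2 / (4 * lam) = lam * (norm y - L / (2 * lam))\<^sup>2"
      using assms(2) by (simp add: field_simps power2_eq_square)
    moreover have "\<dots> \<ge> 0" using assms(2) by simp
    ultimately show "F 0 - L\<^sup>2 / (4 * lam) \<le> F y + lam * (norm y)\<^sup>2" by linarith
  qed
qed

lemma upper_transform_eq_lower_transform:
  "upper_transform lam F x = - lower_transform lam (\<lambda>y. - F y) x"
  by (simp add: upper_transform_def lower_transform_def)

text \<open>This symmetry lets the roles of the two convex functions be exchanged.\<close>

lemma edge_transform_uminus: "edge_transform lam (\<lambda>y. - F y) = edge_transform lam F"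
  by (rule ext) (simp add: edge_transform_def upper_transform_eq_lower_transform)

lemma lower_transform_le:
  fixes F :: "'a::real_inner \<Rightarrow> real"
  assumes "L-lipschitz_on UNIV F" "lam > 0"
  shows "lower_transform lam F x \<le> F x"
proof -
  obtain \<psi> where "convex_on UNIV \<psi>" "\<psi> \<le> (\<lambda>y. F y + lam * (norm y)\<^sup>2)"
    using lipschitz_quadratic_minorant[OF assms] by blast
  from le_funD[OF convex_envelope(2)[OF this], of x]
  show ?thesis by (simp add: lower_transform_def)
qed

text \<open>Subtracting an affine function does not affect the envelope at a convex combination.\<close>

lemma lower_transform_le_hull:
  fixes F :: "'a::real_inner \<Rightarrow> real"
  assumes F: "L-lipschitz_on UNIV F" "lam > 0"
    and x: "x \<in> convex hull Y"
    and Y: "\<And>y. y \<in> Y \<Longrightarrow> F y + lam * (norm (y - x))\<^sup>2 \<le> b + v \<bullet> (y - x)"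
  shows "lower_transform lam F x \<le> b"
proof -
  define Q where "Q = (\<lambda>y. F y + lam * (norm y)\<^sup>2)"
  obtain \<psi> where \<psi>: "convex_on UNIV \<psi>" "\<psi> \<le> Q"
    using lipschitz_quadratic_minorant[OF F] by (auto simp: Q_def)
  \<comment> \<open>The slope is \<open>v\<close> plus the gradient of lam times the squared norm at
    x; the subtracted affine function vanishes at x.\<close>
  define w where "w = v + (2 * lam) *\<^sub>R x"
  define \<phi> where "\<phi> y = convex_envelope Q y + (- w) \<bullet> (y - x)" for y
  have "convex_on UNIV (\<lambda>y. (- w) \<bullet> (y - x))"
    by (intro convex_onI) (auto simp: algebra_simps)
  then have "convex_on UNIV \<phi>"
    unfolding \<phi>_def by (intro convex_on_add convex_envelope(1)[OF \<psi>])
  then have conv: "convex_on (convex hull Y) \<phi>"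
    by (rule convex_on_subset) (auto simp: convex_convex_hull)
  have "\<phi> y \<le> b + lam * (norm x)\<^sup>2" if "y \<in> Y" for y
  proof -
    have "convex_envelope Q y \<le> Q y" using le_funD[OF convex_envelope(2)[OF \<psi>]] .
    moreover have "lam * (norm y)\<^sup>2 = lam * (norm (y - x))\<^sup>2 + (2 * lam) * (x \<bullet> (y - x)) + lam * (norm x)\<^sup>2"
      unfolding power2_norm_eq_inner by (simp add: algebra_simps inner_commute)
    ultimately show ?thesis using Y[OF that]
      by (simp add: \<phi>_def Q_def w_def inner_diff_left)
  qed
  then have "\<phi> x \<le> b + lam * (norm x)\<^sup>2"
    using convex_on_convex_hull_bound[OF conv] x by blast
  then show ?thesis by (simp add: lower_transform_def \<phi>_def Q_def)
qed

text \<open>The lower transform lies below F and the upper one above it. This settles the case of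
  equal radii.\<close>

lemma edge_transform_nonneg:
  fixes F :: "'a::real_inner \<Rightarrow> real"
  assumes "L-lipschitz_on UNIV F" "lam > 0"
  shows "edge_transform lam F x \<ge> 0"
proof -
  have "L-lipschitz_on UNIV (\<lambda>y. - F y)" using assms(1) by (simp add: lipschitz_on_minus)
  from lower_transform_le[OF this assms(2), of x] lower_transform_le[OF assms, of x]
  show ?thesis by (simp add: edge_transform_def upper_transform_eq_lower_transform)
qed

text \<open>
  The test points are \<open>x + s (u - c) / r\<^sub>g\<close> for the contact points \<open>u\<close> of the bounding sphere of
  the subdifferential of \<open>g\<close>, with centre \<open>c\<close>; the bound \<open>lam s\<^sup>2 - (r\<^sub>g - r\<^sub>h) s\<close> obtained there
  is minimal at \<open>s = (r\<^sub>g - r\<^sub>h) / (2 lam)\<close>.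
\<close>

lemma eventually_edge_transform_ge:
  fixes g h F :: "'a::euclidean_space \<Rightarrow> real"
  assumes \<Omega>: "open \<Omega>" "x \<in> \<Omega>"
    and g: "continuous_on \<Omega> g" "convex_on \<Omega> g"
    and h: "continuous_on \<Omega> h" "convex_on \<Omega> h"
    and F: "L-lipschitz_on UNIV F" and eq: "\<forall>\<^sub>F y in nhds x. F y = g y - h y"
    and rg: "rg = min_bounding_radius (subdifferential \<Omega> g x)"
    and rh: "rh = min_bounding_radius (subdifferential \<Omega> h x)"
    and less: "rh < rg" and e: "\<epsilon> > 0"
  shows "\<forall>\<^sub>F lam in at_top. lam * edge_transform lam F x \<ge> (rg - rh)\<^sup>2 / 4 - \<epsilon>"
proof -
  define \<Delta> where "\<Delta> = rg - rh"
  have \<Delta>: "\<Delta> > 0" using less by (simp add: \<Delta>_def)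
  define Kg where "Kg = subdifferential \<Omega> g x"
  define Kh where "Kh = subdifferential \<Omega> h x"
  have Kg: "compact Kg" "Kg \<noteq> {}"
    unfolding Kg_def by (rule subdifferential_compact subdifferential_nonempty; fact)+
  have Kh: "compact Kh" "Kh \<noteq> {}"
    unfolding Kh_def by (rule subdifferential_compact subdifferential_nonempty; fact)+
  obtain c where c: "Kg \<subseteq> cball c rg"
    using min_bounding_radius(1)[OF compact_imp_bounded[OF Kg(1)] Kg(2)] unfolding rg Kg_def by blast
  obtain d where d: "Kh \<subseteq> cball d rh"
    using min_bounding_radius(1)[OF compact_imp_bounded[OF Kh(1)] Kh(2)] unfolding rh Kh_def by blast
  \<comment> \<open>Needed for \<open>rg > 0\<close>, since the test points are scaled by division
    by \<open>rg\<close>.\<close>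
  have rh0: "rh \<ge> 0" using d Kh(2) by (metis cball_eq_empty not_le subset_empty)
  with less have rg0: "rg > 0" by simp
  define A where "A = {u\<in>Kg. norm (u - c) = rg}"
  have cA: "c \<in> convex hull A"
    unfolding A_def using Kg c by (rule min_bounding_center_in_convex_hull) (simp add: rg Kg_def)
  \<comment> \<open>After multiplication by lam, the error e' s becomes e' \<Delta> / 2, which this
    choice makes equal to \<epsilon>.\<close>
  define e' where "e' = 2 * \<epsilon> / \<Delta>"
  have e': "e' > 0" "e' * \<Delta> / 2 = \<epsilon>" using e \<Delta> by (auto simp: e'_def)
  have "\<forall>\<^sub>F y in nhds x. h y - h x \<le> d \<bullet> (y - x) + (rh + e') * norm (y - x)"
    using d e' \<Omega> h by (intro convex_increment_le) (auto simp: Kh_def)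
  moreover have "\<forall>\<^sub>F y in nhds x. y \<in> \<Omega>" using \<Omega> by (simp add: eventually_nhds_in_open)
  ultimately have "\<forall>\<^sub>F y in nhds x. y \<in> \<Omega> \<and> F y = g y - h y \<and>
      h y - h x \<le> d \<bullet> (y - x) + (rh + e') * norm (y - x)"
    using eq by eventually_elim auto
  then obtain \<delta> where \<delta>: "\<delta> > 0" "\<And>y. dist y x < \<delta> \<Longrightarrow> y \<in> \<Omega>"
    "\<And>y. dist y x < \<delta> \<Longrightarrow> F y = g y - h y"
    "\<And>y. dist y x < \<delta> \<Longrightarrow> h y - h x \<le> d \<bullet> (y - x) + (rh + e') * norm (y - x)"
    unfolding eventually_nhds_metric by blast
  show ?thesis
    \<comment> \<open>The second threshold says exactly that the optimal radius \<open>s\<close> is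
      below \<open>\<delta>\<close>.\<close>
    using eventually_gt_at_top[of "0::real"] eventually_gt_at_top[of "\<Delta> / (2 * \<delta>)"]
  proof eventually_elim
    case (elim lam)
    define s where "s = \<Delta> / (2 * lam)"
    have s: "0 < s" "s < \<delta>" using elim \<Delta> \<delta>(1) by (auto simp: s_def field_simps)
    \<comment> \<open>This affine map sends c to x, so x inherits membership in the hull.\<close>
    define Y where "Y = (\<lambda>u. (x - (s / rg) *\<^sub>R c) + (s / rg) *\<^sub>R u) ` A"
    have "convex hull Y = (\<lambda>u. (x - (s / rg) *\<^sub>R c) + (s / rg) *\<^sub>R u) ` (convex hull A)"
      unfolding Y_def by (rule convex_hull_affinity)
    with cA have xY: "x \<in> convex hull Y" by force
    \<comment> \<open>The slope d - c is the same at all test points, as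
      \<open>lower_transform_le_hull\<close> requires.\<close>
    have bound: "- F y + lam * (norm (y - x))\<^sup>2 \<le> (- F x + (lam * s\<^sup>2 - (\<Delta> - e') * s)) + (d - c) \<bullet> (y - x)"
      if yY: "y \<in> Y" for y
    proof -
      obtain u where u: "u \<in> Kg" "norm (u - c) = rg"
        and "y = (x - (s / rg) *\<^sub>R c) + (s / rg) *\<^sub>R u"
        using yY unfolding Y_def A_def by blast
      then have y: "y - x = (s / rg) *\<^sub>R (u - c)" by (simp add: scaleR_diff_right)
      have ny: "norm (y - x) = s" unfolding y using u s rg0 by simp
      then have dy: "dist y x < \<delta>" using s by (simp add: dist_norm)
      have "g y - g x - u \<bullet> (y - x) \<ge> 0"
        using u(1) \<delta>(2)[OF dy] by (simp add: Kg_def subdifferential_def)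
      moreover have "u \<bullet> (y - x) = (u - c) \<bullet> (y - x) + c \<bullet> (y - x)" by (simp add: inner_diff_left)
      moreover have "(u - c) \<bullet> (y - x) = rg * s"
        unfolding y using u(2) rg0 by (simp add: dot_square_norm power2_eq_square)
      moreover have "h y - h x \<le> d \<bullet> (y - x) + (rh + e') * s" using \<delta>(4)[OF dy] ny by simp
      moreover have "F y = g y - h y" "F x = g x - h x" using \<delta>(1,3) dy by auto
      ultimately show ?thesis unfolding ny \<Delta>_def by (simp add: algebra_simps)
    qed
    have "L-lipschitz_on UNIV (\<lambda>y. - F y)" using F by (simp add: lipschitz_on_minus)
    then have "lower_transform lam (\<lambda>y. - F y) x \<le> - F x + (lam * s\<^sup>2 - (\<Delta> - e') * s)"
      using elim(1) xY bound by (rule lower_transform_le_hull)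
    moreover have "lower_transform lam F x \<le> F x" using F elim(1) by (rule lower_transform_le)
    ultimately have "edge_transform lam F x \<ge> (\<Delta> - e') * s - lam * s\<^sup>2"
      by (simp add: edge_transform_def upper_transform_eq_lower_transform)
    then have "lam * edge_transform lam F x \<ge> lam * ((\<Delta> - e') * s - lam * s\<^sup>2)"
      using elim(1) by (intro mult_left_mono) auto
    also have "lam * ((\<Delta> - e') * s - lam * s\<^sup>2) = (\<Delta> - e') * (lam * s) - (lam * s)\<^sup>2"
      by (simp add: algebra_simps power2_eq_square)
    also have "\<dots> = (\<Delta> - e') * (\<Delta> / 2) - (\<Delta> / 2)\<^sup>2"
      using elim(1) by (simp add: s_def)
    also have "\<dots> = \<Delta>\<^sup>2 / 4 - e' * \<Delta> / 2"
      by (simp add: left_diff_distrib power_divide) (simp add: power2_eq_square)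
    finally show ?case using e' by (simp add: \<Delta>_def)
  qed
qed

theorem corollary1p8:
  fixes \<Omega> G :: "(real ^ 'n) set"
    and g h f f\<^sub>G :: "real ^ 'n \<Rightarrow> real"
    and x\<^sub>0 :: "real ^ 'n"
  assumes "\<Omega> \<noteq> {}" and "open \<Omega>" and "convex \<Omega>"
    and "continuous_on \<Omega> g" and "convex_on \<Omega> g"
    and "continuous_on \<Omega> h" and "convex_on \<Omega> h"
    and "\<And>x. x \<in> \<Omega> \<Longrightarrow> f x = g x - h x"
    and "x\<^sub>0 \<in> \<Omega>"
    and "open G" and "bounded G" and "x\<^sub>0 \<in> G" and "closure G \<subseteq> \<Omega>"
    and "lipschitz_extension (closure G) f f\<^sub>G"
  shows "Liminf at_top (\<lambda>lam::real. ereal (lam * edge_transform lam f\<^sub>G x\<^sub>0)) \<ge>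
    ereal ((min_bounding_radius (subdifferential \<Omega> g x\<^sub>0)
            - min_bounding_radius (subdifferential \<Omega> h x\<^sub>0))\<^sup>2 / 4)"
proof -
  define rg where "rg = min_bounding_radius (subdifferential \<Omega> g x\<^sub>0)"
  define rh where "rh = min_bounding_radius (subdifferential \<Omega> h x\<^sub>0)"
  obtain L where L: "L-lipschitz_on UNIV f\<^sub>G" and ext: "\<And>x. x \<in> closure G \<Longrightarrow> f\<^sub>G x = f x"
    using assms(14) by (auto simp: lipschitz_extension_def)
  then have L': "L-lipschitz_on UNIV (\<lambda>y. - f\<^sub>G y)" by (simp add: lipschitz_on_minus)
  have "\<forall>\<^sub>F y in nhds x\<^sub>0. y \<in> G" using assms by (simp add: eventually_nhds_in_open)
  then have eq: "\<forall>\<^sub>F y in nhds x\<^sub>0. f\<^sub>G y = g y - h y"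
  proof eventually_elim
    case (elim y)
    then have "y \<in> closure G" using closure_subset by blast
    then show ?case using ext assms(8,13) by auto
  qed
  then have eq': "\<forall>\<^sub>F y in nhds x\<^sub>0. - f\<^sub>G y = h y - g y"
    by eventually_elim simp
  have ev: "\<forall>\<^sub>F lam in at_top. lam * edge_transform lam f\<^sub>G x\<^sub>0 \<ge> (rg - rh)\<^sup>2 / 4 - \<epsilon>"
    if "\<epsilon> > 0" for \<epsilon>
  proof (cases rg rh rule: linorder_cases)
    case less
    \<comment> \<open>Here h has the larger radius, so the estimate is applied to h - g and the
      negated extension.\<close>
    from eventually_edge_transform_ge[OF assms(2,9,6,7,4,5) L' eq' rh_def rg_def less that]
    show ?thesis by (simp add: edge_transform_uminus power2_commute[of rh rg])
  next
    case equal
    show ?thesis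
      using eventually_gt_at_top[of "0::real"]
    proof eventually_elim
      case (elim lam)
      then have "0 \<le> lam * edge_transform lam f\<^sub>G x\<^sub>0"
        using edge_transform_nonneg[OF L elim] by simp
      with equal that show ?case by simp
    qed
  next
    case greater
    from eventually_edge_transform_ge[OF assms(2,9,4,5,6,7) L eq rg_def rh_def greater that]
    show ?thesis .
  qed
  \<comment> \<open>The loss \<epsilon> is moved to the right so that it can be sent to 0 in the
    extended reals.\<close>
  have "ereal ((rg - rh)\<^sup>2 / 4) \<le> Liminf at_top (\<lambda>lam. ereal (lam * edge_transform lam f\<^sub>G x\<^sub>0)) + ereal \<epsilon>"
    if "\<epsilon> > 0" for \<epsilon>
  proof -
    have "ereal ((rg - rh)\<^sup>2 / 4 - \<epsilon>) \<le> Liminf at_top (\<lambda>lam. ereal (lam * edge_transform lam f\<^sub>G x\<^sub>0))"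
      using ev[OF that] by (intro Liminf_bounded) simp
    from add_right_mono[OF this, of "ereal \<epsilon>"] show ?thesis by simp
  qed
  then show ?thesis unfolding rg_def rh_def by (rule ereal_le_epsilon2)
qed

end
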